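(* Let $k\ge 3$ and $t>2^{k-1}$ be integers. Then $f_k(n,t)=\Omega(\log n)$.
   Context: Let $[n]=\{1,\dots,n\}$. A permutation $\rho$ of a finite set $X$ is a total order $<_\rho$ of the elements of $X$; if $Y\subseteq X$, then $\rho$ induces a permutation on $Y$ by restricting the order. For $t\ge 1$, a family $\mathcal{P}$ of permutations of $[n]$ $t$-shatters a set $X\subseteq[n]$ if the permutations of $\mathcal{P}$ induce at least $t$ distinct permutations on $X$. For $n \ge k$, $f_k(n,t)$ denotes the minimum number of permutations in a family of permutations of $[n]$ that $t$-shatters every subset of $[n]$ of size $k$ (interpreted as $+\infty$ if no such family exists, i.e. if $t>k!$). Asymptotic notation is for $k$ and $t$ fixed and $n\to\infty$; the implied constants may depend on $k$ and $t$. *)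

theory Defs
  imports Complex_Main "HOL-Library.Extended_Nat" "HOL-Library.Extended_Real"
begin

text \<open>
  A permutation of \<open>X\<close> is a strict total order on \<open>X\<close>. The condition \<open>r \<subseteq> X \<times> X\<close> is needed because
  \<^const>\<open>strict_linear_order_on\<close> does not confine the relation to its carrier; without it
  different relations could represent the same order on \<open>X\<close>.
\<close>

definition permutation_orders :: "'a set \<Rightarrow> 'a rel set" where
  "permutation_orders X = {r. r \<subseteq> X \<times> X \<and> strict_linear_order_on X r}"

definition induced_order :: "'a rel \<Rightarrow> 'a set \<Rightarrow> 'a rel" where
  "induced_order r Y = r \<inter> Y \<times> Y"

definition shatters :: "nat \<Rightarrow> 'a rel set \<Rightarrow> 'a set \<Rightarrow> bool" where
  "shatters t P X \<longleftrightarrow> t \<le> card ((\<lambda>r. induced_order r X) ` P)"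

text \<open>
  Every family of permutations of \<open>{1..n}\<close> is finite, so \<^const>\<open>card\<close> is its true size, here and in
  \<open>shatters\<close>. The infimum of the empty set in \<^typ>\<open>enat\<close> is \<open>\<infinity>\<close>, and that of a nonempty set is
  attained.
\<close>

definition shatter_number :: "nat \<Rightarrow> nat \<Rightarrow> nat \<Rightarrow> enat" where
  "shatter_number k n t =
     Inf {enat (card P) | P. P \<subseteq> permutation_orders {1..n} \<and>
                            (\<forall>X. X \<subseteq> {1..n} \<and> card X = k \<longrightarrow> shatters t P X)}"

text \<open>
  The class \<open>\<Omega>(g)\<close> as \<open>n \<rightarrow> \<infinity>\<close>, for a function that may take the value \<open>\<infinity>\<close>; the Landau symbols
  of the library only cover functions into normed fields.
\<close>

definition enat_bigomega :: "(nat \<Rightarrow> real) \<Rightarrow> (nat \<Rightarrow> enat) set" where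
  "enat_bigomega g =
     {f. \<exists>c>0. \<forall>\<^sub>F n in sequentially. ereal (c * \<bar>g n\<bar>) \<le> ereal_of_enat (f n)}"

end

theory Submission
  imports Defs "HOL-Library.FuncSet"
begin

text \<open>
  The bound is an iterated pigeonhole argument. Let \<open>P\<close> consist of \<open>m\<close> permutations and fix an
  element \<open>x\<close>. Every other element \<open>y\<close> has a sign vector in \<open>{+,-}\<^sup>m\<close>, recording which permutations
  put \<open>x\<close> before \<open>y\<close>, so at least a \<open>2\<^sup>-\<^sup>m\<close> fraction of the other elements share one sign vector.
  Seen from this class \<open>B\<close>, every permutation of \<open>P\<close> places \<open>x\<close> entirely below or entirely above
  \<open>B\<close>. Repeating this inside \<open>B\<close> gives, as long as \<open>n\<close> is at least \<open>2 ^ ((m + 1) * (k - 1))\<close>, a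
  sequence \<open>x\<^sub>1, \<dots>, x\<^sub>k\<close> in which every permutation makes each \<open>x\<^sub>i\<close> the minimum or the maximum of
  \<open>x\<^sub>i, \<dots>, x\<^sub>k\<close>. A permutation then induces on this set an order determined by \<open>k - 1\<close> binary choices,
  so at most \<open>2 ^ (k - 1)\<close> orders occur (\<open>few_induced_orders\<close>). Hence a family shattering every
  \<open>k\<close>-set into more than \<open>2 ^ (k - 1)\<close> orders has \<open>n < 2 ^ ((m + 1) * (k - 1))\<close>, which makes \<open>m\<close>
  at least a constant times \<open>ln n\<close>.
\<close>

text \<open>
  There are at most \<open>2 ^ card P\<close> sign vectors. The extra factor 2 in the size of \<open>A\<close> pays for
  removing \<open>x\<close> itself and keeps the bound multiplicative, so that it iterates to a pure power.
\<close>

lemma large_homogeneous_subset: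
  fixes P :: "'a rel set"
  assumes "finite A" "finite P" "x \<in> A" "0 < N" "2 ^ Suc (card P) * N \<le> card A"
  obtains B where "B \<subseteq> A - {x}" "N \<le> card B"
    "\<And>r y z. r \<in> P \<Longrightarrow> y \<in> B \<Longrightarrow> z \<in> B \<Longrightarrow> (x, y) \<in> r \<longleftrightarrow> (x, z) \<in> r"
proof -
  define s where "s = (\<lambda>y. {r \<in> P. (x, y) \<in> r})"
  define B where "B = (\<lambda>S. s -` {S} \<inter> (A - {x}))"
  have "s \<in> (A - {x}) \<rightarrow> Pow P"
    by (auto simp: s_def)
  then obtain S where "card (A - {x}) \<le> card (B S) * card (Pow P)"
    using pigeonhole_card[of s "A - {x}" "Pow P"] assms(1,2) unfolding B_def by auto
  then have large: "2 ^ Suc (card P) * N \<le> card (B S) * 2 ^ card P + 1"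
    using assms by (simp add: card_Pow)
  have "N \<le> card (B S)"
  proof (rule ccontr)
    assume "\<not> N \<le> card (B S)"
    then have "Suc (card (B S)) * 2 ^ card P \<le> N * 2 ^ card P"
      by (intro mult_right_mono) auto
    then have "2 ^ card P + card (B S) * 2 ^ card P \<le> N * 2 ^ card P"
      by (simp only: mult_Suc)
    moreover have "1 \<le> N * 2 ^ card P" "(1::nat) \<le> 2 ^ card P"
      using \<open>0 < N\<close> by (simp_all add: Suc_le_eq)
    moreover have "2 ^ Suc (card P) * N = 2 * (N * 2 ^ card P)"
      by simp
    ultimately show False
      using large by linarith
  qed
  moreover have "B S \<subseteq> A - {x}"
    by (auto simp: B_def)
  moreover have "(x, y) \<in> r \<longleftrightarrow> (x, z) \<in> r" if "r \<in> P" "y \<in> B S" "z \<in> B S" for r y z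
    using that by (auto simp: B_def s_def)
  ultimately show thesis
    using that by blast
qed

text \<open>
  An order that places \<open>x\<close> entirely below or entirely above \<open>X\<close> is recovered from its restriction to
  \<open>X\<close> together with one bit, the side on which \<open>x\<close> lies.
\<close>

lemma card_induced_orders_insert:
  fixes P :: "'a rel set"
  assumes "finite P" "x \<notin> X"
    and lin: "\<And>r. r \<in> P \<Longrightarrow> strict_linear_order_on (insert x X) r"
    and hom: "\<And>r y z. r \<in> P \<Longrightarrow> y \<in> X \<Longrightarrow> z \<in> X \<Longrightarrow> (x, y) \<in> r \<longleftrightarrow> (x, z) \<in> r"
  shows "card ((\<lambda>r. induced_order r (insert x X)) ` P) \<le> 2 * card ((\<lambda>r. induced_order r X) ` P)"
proof -
  let ?g = "\<lambda>(q, below). q \<union> (if below then {x} \<times> X else X \<times> {x})"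
  let ?I = "(\<lambda>r. induced_order r X) ` P"
  have "induced_order r (insert x X) \<in> ?g ` (?I \<times> UNIV)" if "r \<in> P" for r
  proof
    let ?below = "\<forall>y\<in>X. (x, y) \<in> r"
    have r: "trans r" "irrefl r" "total_on (insert x X) r"
      using lin[OF that] by (auto simp: strict_linear_order_on_def)
    have asym: "(x, y) \<in> r \<longleftrightarrow> (y, x) \<notin> r" if "y \<in> X" for y
    proof -
      have "x \<noteq> y"
        using that \<open>x \<notin> X\<close> by blast
      then show ?thesis
        using r that by (metis insertCI irreflD total_on_def transD)
    qed
    have "(x, x) \<notin> r"
      using r by (simp add: irrefl_def)
    show "induced_order r (insert x X) = ?g (induced_order r X, ?below)"
    proof (cases ?below)
      case True
      then show ?thesis
        using asym \<open>(x, x) \<notin> r\<close> by (auto simp: induced_order_def)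
    next
      case False
      then have "\<forall>y\<in>X. (x, y) \<notin> r"
        using hom[OF \<open>r \<in> P\<close>] by blast
      then show ?thesis
        using False asym \<open>(x, x) \<notin> r\<close> by (auto simp: induced_order_def)
    qed
    show "(induced_order r X, ?below) \<in> ?I \<times> UNIV"
      using that by blast
  qed
  then have "card ((\<lambda>r. induced_order r (insert x X)) ` P) \<le> card (?I \<times> (UNIV :: bool set))"
    using \<open>finite P\<close> by (intro surj_card_le) auto
  then show ?thesis
    by (simp add: card_cartesian_product mult.commute)
qed

text \<open>
  The element \<open>x\<close> is chosen before the set \<open>X\<close> that it is added to: \<open>X\<close> comes from the induction
  hypothesis for a class of elements with the same sign vector with respect to \<open>x\<close>. Each of the \<open>j\<close>
  rounds shrinks the ground set by a factor \<open>2 ^ (card P + 1)\<close> and at most doubles the number of orders.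
\<close>

lemma few_induced_orders:
  fixes P :: "'a rel set"
  assumes "finite A" "finite P"
    and "\<And>r. r \<in> P \<Longrightarrow> strict_linear_order_on A r"
    and "2 ^ (Suc (card P) * j) \<le> card A"
  shows "\<exists>X\<subseteq>A. card X = Suc j \<and> card ((\<lambda>r. induced_order r X) ` P) \<le> 2 ^ j"
  using assms
proof (induction j arbitrary: A)
  case 0
  then have "A \<noteq> {}" by auto
  then obtain x where x: "x \<in> A" by blast
  \<comment> \<open>Irreflexivity makes the empty relation the only order induced on a singleton.\<close>
  have "(\<lambda>r. induced_order r {x}) ` P \<subseteq> {{}}"
    using 0 by (auto simp: induced_order_def strict_linear_order_on_def irrefl_def)
  then have "card ((\<lambda>r. induced_order r {x}) ` P) \<le> 1"
    using card_mono[of "{{}}" "(\<lambda>r. induced_order r {x}) ` P"] by simp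
  then show ?case
    using x by (intro exI[of _ "{x}"]) auto
next
  case (Suc j)
  have "A \<noteq> {}"
    using Suc.prems(4) by auto
  then obtain x where x: "x \<in> A" by blast
  have "2 ^ Suc (card P) * 2 ^ (Suc (card P) * j) \<le> card A"
    using Suc.prems(4) by (simp only: power_add[symmetric] mult_Suc_right)
  then obtain B where B: "B \<subseteq> A - {x}" "2 ^ (Suc (card P) * j) \<le> card B"
    and hom: "\<And>r y z. r \<in> P \<Longrightarrow> y \<in> B \<Longrightarrow> z \<in> B \<Longrightarrow> (x, y) \<in> r \<longleftrightarrow> (x, z) \<in> r"
    using large_homogeneous_subset[OF Suc.prems(1,2) x, of "2 ^ (Suc (card P) * j)"] by auto
  have lin: "strict_linear_order_on C r" if "C \<subseteq> A" "r \<in> P" for C r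
    using Suc.prems(3)[OF that(2)] that(1)
    by (auto simp: strict_linear_order_on_def intro: total_on_subset)
  have "finite B" "B \<subseteq> A"
    using B(1) Suc.prems(1) finite_subset by auto
  then obtain X where X: "X \<subseteq> B" "card X = Suc j"
    and few: "card ((\<lambda>r. induced_order r X) ` P) \<le> 2 ^ j"
    using Suc.IH[of B] Suc.prems(2) lin B(2) by blast
  have sub: "insert x X \<subseteq> A" and "x \<notin> X" and "finite X"
    using X(1) B(1) x \<open>finite B\<close> finite_subset by auto
  have "card ((\<lambda>r. induced_order r (insert x X)) ` P) \<le> 2 * card ((\<lambda>r. induced_order r X) ` P)"
    using card_induced_orders_insert[OF Suc.prems(2) \<open>x \<notin> X\<close>] lin[OF sub] hom X(1) by blast
  then have "card ((\<lambda>r. induced_order r (insert x X)) ` P) \<le> 2 ^ Suc j"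
    using few by simp
  moreover have "card (insert x X) = Suc (Suc j)"
    using \<open>x \<notin> X\<close> \<open>finite X\<close> X(2) by simp
  ultimately show ?case
    using sub by blast
qed

theorem theorem1p4:
  fixes k t :: nat
  assumes "k \<ge> 3" and "t > 2 ^ (k - 1)"
  shows "(\<lambda>n. shatter_number k n t) \<in> enat_bigomega (\<lambda>n. ln (real n))"
proof -
  define j where "j = k - 1"
  have j: "0 < j" "k = Suc j"
    using assms(1) by (auto simp: j_def)
  have bound: "ln (real n) \<le> real j * (real (card P) + 1)"
    if "0 < n" and P: "P \<subseteq> permutation_orders {1..n}"
      and sh: "\<forall>X. X \<subseteq> {1..n} \<and> card X = k \<longrightarrow> shatters t P X" for n P
  proof -
    have "permutation_orders {1..n} \<subseteq> Pow ({1..n} \<times> {1..n})"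
      by (auto simp: permutation_orders_def)
    then have "finite P"
      using P by (meson finite_Pow_iff finite_SigmaI finite_atLeastAtMost finite_subset)
    have "n < 2 ^ (Suc (card P) * j)"
    proof (rule ccontr)
      assume "\<not> ?thesis"
      then obtain X where X: "X \<subseteq> {1..n}" "card X = k"
        and few: "card ((\<lambda>r. induced_order r X) ` P) \<le> 2 ^ j"
        using few_induced_orders[of "{1..n}" P j] \<open>finite P\<close> P j
        by (auto simp: permutation_orders_def)
      have "t \<le> card ((\<lambda>r. induced_order r X) ` P)"
        using sh X unfolding shatters_def by blast
      then show False
        using few assms(2) unfolding j_def by linarith
    qed
    then have "real n < real (2 ^ (Suc (card P) * j))"
      by (simp only: of_nat_less_iff)
    then have "ln (real n) \<le> ln (2 ^ (Suc (card P) * j))"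
      using \<open>0 < n\<close> by (simp del: mult_Suc)
    also have "\<dots> = real (Suc (card P) * j) * ln 2"
      by (simp add: ln_realpow)
    also have "\<dots> \<le> real (Suc (card P) * j) * 1"
      using ln_2_less_1 by (intro mult_left_mono) auto
    finally show ?thesis
      by (simp add: algebra_simps)
  qed
  define c where "c = 1 / (2 * real j)"
  have "c > 0"
    using j by (simp add: c_def)
  moreover have "\<forall>\<^sub>F n in sequentially. ereal (c * \<bar>ln (real n)\<bar>) \<le> ereal_of_enat (shatter_number k n t)"
  proof -
    \<comment> \<open>Once \<open>ln n \<ge> 2 * j\<close>, the additive loss of \<open>j\<close> in \<open>bound\<close> costs at most half of \<open>ln n\<close>.\<close>
    have "\<forall>\<^sub>F n in sequentially. 2 * real j \<le> ln (real n)"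
      using filterlim_compose[OF ln_at_top filterlim_real_sequentially]
      by (auto simp: filterlim_at_top)
    then show ?thesis
      using eventually_gt_at_top[of 0]
    proof eventually_elim
      case (elim n)
      define a where "a = c * ln (real n)"
      \<comment> \<open>Rounding \<open>a\<close> up keeps the comparison with the infimum inside \<^typ>\<open>enat\<close>, where the
        infimum is taken.\<close>
      have "enat (nat \<lceil>a\<rceil>) \<le> shatter_number k n t"
        unfolding shatter_number_def
      proof (rule Inf_greatest, clarify)
        fix P assume P: "P \<subseteq> permutation_orders {1..n}"
          "\<forall>X. X \<subseteq> {1..n} \<and> card X = k \<longrightarrow> shatters t P X"
        have "ln (real n) \<le> 2 * real j * real (card P)"
          using bound[OF _ P] elim by (simp add: algebra_simps)
        then have "a \<le> real (card P)"
          using j by (simp add: a_def c_def field_simps)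
        then show "enat (nat \<lceil>a\<rceil>) \<le> enat (card P)"
          by (simp add: ceiling_le_iff nat_le_iff)
      qed
      then have "ereal_of_enat (enat (nat \<lceil>a\<rceil>)) \<le> ereal_of_enat (shatter_number k n t)"
        by (simp only: ereal_of_enat_le_iff)
      moreover have "ereal a \<le> ereal_of_enat (enat (nat \<lceil>a\<rceil>))"
        by (simp add: real_nat_ceiling_ge)
      ultimately have "ereal a \<le> ereal_of_enat (shatter_number k n t)"
        by (rule order_trans[rotated])
      moreover have "\<bar>ln (real n)\<bar> = ln (real n)"
        using elim by simp
      ultimately show ?case
        by (simp add: a_def)
    qed
  qed
  ultimately show ?thesis
    unfolding enat_bigomega_def by blast
qed

end
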